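(* Let $(x_k,\tau_k,y_k)_{k\in\mathbb{N}}$ be the sequence generated by IE-FISTA (with associated $\tilde x_k,v_k,\varepsilon_k$). Then $$r_k\in\partial_{\varepsilon_{k}}g(\tilde x_{k})+\nabla f(y_{k-1})\subset\partial_{\varepsilon_k+\mu_k}F(\tilde x_{k}),\qquad k\in\mathbb{N},$$ where $r_k:=v_{k}+L(y_{k-1}-\tilde x_{k})$. Additionally, if $\sigma<1$, then IE-FISTA generates a $\rho$-approximate solution $\tilde x_\ell$ of the problem $\min_{x\in\mathbb{E}}F(x)$ with residues $(r_\ell,\varepsilon_\ell+\mu_\ell)$ in at most $k=\mathcal{O}\big((d_0/\rho)^{2/3}\big)$ iterations, where $\rho\in(0,1)$ is a given tolerance and $d_0$ is the distance from $x_0$ to $S_*$.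
   Context: $\mathbb{N}=\{1,2,\dots\}$. $\mathbb{E}$ is a finite-dimensional real vector space with inner product $\langle\cdot,\cdot\rangle$ and induced norm $\|\cdot\|$. $f\colon\mathbb{E}\to\mathbb{R}$ is a differentiable convex function whose gradient is $L$-Lipschitz continuous, $L>0$; $g\colon\mathbb{E}\to\mathbb{R}\cup\{+\infty\}$ is a lower semicontinuous convex function, not necessarily differentiable; $F:=f+g$. The optimal value $F^*$ of $\min_{x\in\mathbb{E}}F(x)$ is assumed to be a real number, and the set $S_*$ of minimizers of $F$ is assumed nonempty. For $\varepsilon\ge 0$ and a convex function $h\colon\mathbb{E}\to\mathbb{R}\cup\{+\infty\}$, $\partial_\varepsilon h(x):=\{u\in\mathbb{E}\mid h(y)\ge h(x)+\langle u,y-x\rangle-\varepsilon\ \ \forall y\in\mathbb{E}\}$. Given a tolerance $\rho>0$, a point $x\in\mathbb{E}$ is said to be a $\rho$-approximate solution of $\min_{x\in\mathbb{E}}F(x)$ with residues $(v,\varepsilon)\in\mathbb{E}\times[0,+\infty)$ if and only if $v\in\partial_\varepsilon F(x)$ and $\max\{\|v\|,\varepsilon\}\le\rho$. IE-FISTA: let $x_0\in\mathbb{E}$, $\alpha>1/L$ and $\sigma\in[0,1]$ be given; set $\lambda:=\alpha/(1+\alpha L)$, $\tau_0:=0$, $\tilde x_0:=x_0$. For $k=0,1,2,\dots$ compute $$\tau_{k+1}:=\tau_k+\frac{\lambda+\sqrt{\lambda^2+4\lambda\tau_k}}{2},\qquad y_k:=\frac{\tau_k}{\tau_{k+1}}\tilde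 x_k+\frac{\tau_{k+1}-\tau_k}{\tau_{k+1}}x_k,$$ find a triple $(\tilde x_{k+1},v_{k+1},\varepsilon_{k+1})\in\mathbb{E}\times\mathbb{E}\times[0,+\infty)$ such that $$v_{k+1}\in\partial_{\varepsilon_{k+1}}g(\tilde x_{k+1})+L(\tilde x_{k+1}-y_k)+\nabla f(y_k),\qquad \|\alpha v_{k+1}+\tilde x_{k+1}-y_k\|^2+2\alpha\varepsilon_{k+1}\le\sigma^2\|\tilde x_{k+1}-y_k\|^2,$$ and set $$x_{k+1}:=x_k-(\tau_{k+1}-\tau_k)\big(v_{k+1}+L(y_k-\tilde x_{k+1})\big).$$ For $k\in\mathbb{N}$, $\mu_k:=f(\tilde x_k)-\big[f(y_{k-1})+\langle\nabla f(y_{k-1}),\tilde x_k-y_{k-1}\rangle\big]$. *)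

theory Defs
  imports "HOL-Analysis.Analysis"
begin

text \<open>Functions with values in the reals extended by \<open>+\<infinity>\<close> are modelled as \<^typ>\<open>ereal\<close>-valued
  functions that avoid \<open>-\<infinity>\<close>. In \<open>convex_ereal\<close> the endpoint cases are harmless because
  \<open>0 * \<infinity> = 0\<close> for \<^typ>\<open>ereal\<close>.\<close>

definition convex_ereal :: "('a::real_vector \<Rightarrow> ereal) \<Rightarrow> bool" where
  "convex_ereal h \<longleftrightarrow> (\<forall>x y. \<forall>t\<in>{0..1::real}.
     h ((1 - t) *\<^sub>R x + t *\<^sub>R y) \<le> ereal (1 - t) * h x + ereal t * h y)"

definition lsc :: "('a::topological_space \<Rightarrow> ereal) \<Rightarrow> bool" where
  "lsc h \<longleftrightarrow> (\<forall>x. h x \<le> Liminf (at x) h)"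

definition eps_subdiff :: "real \<Rightarrow> ('a::real_inner \<Rightarrow> ereal) \<Rightarrow> 'a \<Rightarrow> 'a set" where
  "eps_subdiff \<epsilon> h x = {u. \<forall>y. h y \<ge> h x + ereal (u \<bullet> (y - x) - \<epsilon>)}"

definition minimizers :: "('a \<Rightarrow> ereal) \<Rightarrow> 'a set" where
  "minimizers h = {x. \<forall>y. h x \<le> h y}"

definition composite :: "('a \<Rightarrow> real) \<Rightarrow> ('a \<Rightarrow> ereal) \<Rightarrow> 'a \<Rightarrow> ereal" where
  "composite f g x = ereal (f x) + g x"

text \<open>The argument \<open>gradf\<close> is the gradient map of \<open>f\<close>; its existence is the differentiability
  of \<open>f\<close>. The last two conditions say that the optimal value is a real number and is attained.\<close>

definition composite_problem ::
  "real \<Rightarrow> ('a::euclidean_space \<Rightarrow> real) \<Rightarrow> ('a \<Rightarrow> 'a) \<Rightarrow> ('a \<Rightarrow> ereal) \<Rightarrow> bool" where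
  "composite_problem L f gradf g \<longleftrightarrow>
     convex_on UNIV f \<and> (\<forall>x. GDERIV f x :> gradf x) \<and> L-lipschitz_on UNIV gradf \<and>
     (\<forall>x. g x \<noteq> -\<infinity>) \<and> convex_ereal g \<and> lsc g \<and>
     \<bar>INF x. composite f g x\<bar> \<noteq> \<infinity> \<and> minimizers (composite f g) \<noteq> {}"

definition approx_solution ::
  "('a::real_inner \<Rightarrow> ereal) \<Rightarrow> real \<Rightarrow> 'a \<Rightarrow> 'a \<Rightarrow> real \<Rightarrow> bool" where
  "approx_solution F \<rho> x v \<epsilon> \<longleftrightarrow> 0 \<le> \<epsilon> \<and> v \<in> eps_subdiff \<epsilon> F x \<and> max (norm v) \<epsilon> \<le> \<rho>"

text \<open>The inner triple is not uniquely determined, so the algorithm is a predicate on whole runs.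
  The starting point is \<open>x 0\<close>; the values \<open>v 0\<close> and \<open>\<epsilon> 0\<close> are irrelevant.\<close>

definition ie_fista ::
  "real \<Rightarrow> real \<Rightarrow> real \<Rightarrow> ('a::euclidean_space \<Rightarrow> 'a) \<Rightarrow> ('a \<Rightarrow> ereal) \<Rightarrow>
   (nat \<Rightarrow> 'a) \<Rightarrow> (nat \<Rightarrow> real) \<Rightarrow> (nat \<Rightarrow> 'a) \<Rightarrow> (nat \<Rightarrow> 'a) \<Rightarrow> (nat \<Rightarrow> 'a) \<Rightarrow> (nat \<Rightarrow> real) \<Rightarrow> bool"
where
  "ie_fista L \<alpha> \<sigma> gradf g x \<tau> y xt v \<epsilon> \<longleftrightarrow>
     (let lam = \<alpha> / (1 + \<alpha> * L) in
      \<tau> 0 = 0 \<and> xt 0 = x 0 \<and>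
      (\<forall>k.
        \<tau> (Suc k) = \<tau> k + (lam + sqrt (lam\<^sup>2 + 4 * lam * \<tau> k)) / 2 \<and>
        y k = (\<tau> k / \<tau> (Suc k)) *\<^sub>R xt k + ((\<tau> (Suc k) - \<tau> k) / \<tau> (Suc k)) *\<^sub>R x k \<and>
        0 \<le> \<epsilon> (Suc k) \<and>
        v (Suc k) \<in> (\<lambda>u. u + L *\<^sub>R (xt (Suc k) - y k) + gradf (y k))
                      ` eps_subdiff (\<epsilon> (Suc k)) g (xt (Suc k)) \<and>
        (norm (\<alpha> *\<^sub>R v (Suc k) + xt (Suc k) - y k))\<^sup>2 + 2 * \<alpha> * \<epsilon> (Suc k)
          \<le> \<sigma>\<^sup>2 * (norm (xt (Suc k) - y k))\<^sup>2 \<and>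
        x (Suc k) = x k - (\<tau> (Suc k) - \<tau> k) *\<^sub>R (v (Suc k) + L *\<^sub>R (y k - xt (Suc k)))))"

text \<open>In the next two definitions the index \<open>k\<close> is meant to be at least \<open>1\<close>.\<close>

definition ie_fista_mu ::
  "('a::real_inner \<Rightarrow> real) \<Rightarrow> ('a \<Rightarrow> 'a) \<Rightarrow> (nat \<Rightarrow> 'a) \<Rightarrow> (nat \<Rightarrow> 'a) \<Rightarrow> nat \<Rightarrow> real" where
  "ie_fista_mu f gradf y xt k =
     f (xt k) - (f (y (k - 1)) + gradf (y (k - 1)) \<bullet> (xt k - y (k - 1)))"

definition ie_fista_res ::
  "real \<Rightarrow> (nat \<Rightarrow> 'a::real_vector) \<Rightarrow> (nat \<Rightarrow> 'a) \<Rightarrow> (nat \<Rightarrow> 'a) \<Rightarrow> nat \<Rightarrow> 'a" where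
  "ie_fista_res L y xt v k = v k + L *\<^sub>R (y (k - 1) - xt k)"

end

theory Submission
  imports Defs
begin

text \<open>
  The inclusion adds the inexact subgradient inequality for \<open>g\<close> to the gradient inequality for
  \<open>f\<close> at \<open>y (k - 1)\<close>. The linearization of \<open>f\<close> is taken at \<open>y (k - 1)\<close> instead of \<open>xt k\<close>, and \<open>\<mu> k\<close>
  is exactly the error this causes (lemma \<open>composite_eps_subgradient\<close>).

  For the rate, IE-FISTA is read as an accelerated hybrid proximal extragradient method with
  stepsize \<open>lam = \<alpha> / (1 + \<alpha> L)\<close>, applied to the whole function \<open>F = f + g\<close>. In terms of the
  residue \<open>r = v + L (y - xt)\<close> one has \<open>\<alpha> v + xt - y = (1 + \<alpha> L) (lam r + xt - y)\<close>. The descent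
  lemma gives \<open>\<mu> \<le> L / 2 \<parallel>xt - y\<parallel>\<^sup>2\<close>, so the error criterion of the algorithm becomes
  \<open>\<parallel>lam r + xt - y\<parallel>\<^sup>2 + 2 lam (\<epsilon> + \<mu>) \<le> s \<parallel>xt - y\<parallel>\<^sup>2\<close> with \<open>s = (\<sigma>\<^sup>2 + \<alpha> L) / (1 + \<alpha> L)\<close>
  (lemma \<open>relative_error\<close>). The point is that \<open>\<sigma> < 1\<close> yields \<open>s < 1\<close>.

  For a minimizer \<open>p\<close>, the energy \<open>\<tau> k (F (xt k) - F p) + \<parallel>x k - p\<parallel>\<^sup>2 / 2\<close> then drops in every step
  by at least a multiple of \<open>\<tau> (k + 1) \<parallel>xt (k + 1) - y k\<parallel>\<^sup>2\<close> (lemma \<open>accelerated_step\<close>). These terms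
  therefore have a sum of order at most \<open>d0\<^sup>2\<close>, where \<open>d0\<close> is the distance from \<open>x 0\<close> to the
  minimizers. As \<open>\<tau> k\<close> grows at least like \<open>k\<^sup>2\<close>, the weights up to \<open>n\<close> sum to at least the order
  \<open>n\<^sup>3\<close>, so some \<open>l \<le> n\<close> has \<open>\<parallel>xt l - y (l - 1)\<parallel>\<^sup>2 = O(d0\<^sup>2 / n\<^sup>3)\<close> (lemma \<open>small_displacement\<close>).
  The relative error criterion bounds \<open>\<parallel>r l\<parallel>\<close> by the displacement and \<open>\<epsilon> l + \<mu> l\<close> by its square.
  Hence \<open>n\<close> of order \<open>(d0 / \<rho>) powr (2 / 3)\<close> suffices; the second residue needs only the order
  \<open>(d0\<^sup>2 / \<rho>) powr (1 / 3)\<close>, which is no larger because \<open>\<rho> < 1\<close>.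
\<close>

section \<open>Smooth convex functions\<close>

lemma GDERIV_along_line:
  fixes f :: "'a::real_inner \<Rightarrow> real"
  assumes "\<And>x. GDERIV f x :> gradf x"
  shows "((\<lambda>t. f (y + t *\<^sub>R d)) has_real_derivative gradf (y + t *\<^sub>R d) \<bullet> d) (at t)"
proof -
  have line: "((\<lambda>t. y + t *\<^sub>R d) has_derivative (\<lambda>h. h *\<^sub>R d)) (at t)"
    by (auto intro!: derivative_eq_intros)
  have "(f has_derivative (\<lambda>h. gradf (y + t *\<^sub>R d) \<bullet> h)) (at (y + t *\<^sub>R d))"
    using assms[of "y + t *\<^sub>R d"] by (simp add: gderiv_def inner_commute)
  from has_derivative_compose[OF line this] show ?thesis
    unfolding has_field_derivative_def
    by (rule has_derivative_eq_rhs) (simp add: fun_eq_iff mult.commute)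
qed

lemma convex_gradient_inequality:
  fixes f :: "'a::real_inner \<Rightarrow> real"
  assumes "convex_on UNIV f" and "\<And>x. GDERIV f x :> gradf x"
  shows "f y + gradf y \<bullet> (z - y) \<le> f z"
proof -
  let ?\<phi> = "\<lambda>t::real. f (y + t *\<^sub>R (z - y))"
  have "convex_on UNIV ?\<phi>"
  proof (rule convex_onI)
    fix t a b :: real
    assume t: "0 < t" "t < 1"
    have "y + ((1 - t) *\<^sub>R a + t *\<^sub>R b) *\<^sub>R (z - y)
        = (1 - t) *\<^sub>R (y + a *\<^sub>R (z - y)) + t *\<^sub>R (y + b *\<^sub>R (z - y))"
      by (simp add: algebra_simps)
    then show "?\<phi> ((1 - t) *\<^sub>R a + t *\<^sub>R b) \<le> (1 - t) * ?\<phi> a + t * ?\<phi> b"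
      using convex_onD[OF assms(1), of t "y + a *\<^sub>R (z - y)" "y + b *\<^sub>R (z - y)"] t
      by simp
  qed simp
  moreover have "(?\<phi> has_real_derivative gradf y \<bullet> (z - y)) (at 0 within UNIV)"
    using GDERIV_along_line[OF assms(2), where y = y and d = "z - y" and t = 0] by simp
  ultimately have "?\<phi> 1 - ?\<phi> 0 \<ge> gradf y \<bullet> (z - y) * (1 - 0)"
    by (intro convex_on_imp_above_tangent[where A = UNIV]) auto
  then show ?thesis by simp
qed

text \<open>Along the segment from \<open>y\<close> to \<open>z\<close>, \<open>f\<close> minus the quadratic on the right-hand side has the
  derivative \<open>(gradf (y + t d) - gradf y) \<bullet> d - L t \<parallel>d\<parallel>\<^sup>2\<close>, which is nonpositive by Cauchy-Schwarz.\<close>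

lemma lipschitz_gradient_descent:
  fixes f :: "'a::real_inner \<Rightarrow> real"
  assumes "L-lipschitz_on UNIV gradf" and "\<And>x. GDERIV f x :> gradf x"
  shows "f z \<le> f y + gradf y \<bullet> (z - y) + L / 2 * (norm (z - y))\<^sup>2"
proof -
  define d where "d = z - y"
  let ?\<phi> = "\<lambda>t::real. f (y + t *\<^sub>R d) - t * (gradf y \<bullet> d) - L / 2 * t\<^sup>2 * (norm d)\<^sup>2"
  have "?\<phi> 1 \<le> ?\<phi> 0"
  proof (rule DERIV_nonpos_imp_nonincreasing[where f = ?\<phi>])
    fix t :: real
    assume t: "0 \<le> t" "t \<le> 1"
    have deriv: "(?\<phi> has_real_derivative
        gradf (y + t *\<^sub>R d) \<bullet> d - gradf y \<bullet> d - L * t * (norm d)\<^sup>2) (at t)"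
      by (rule derivative_eq_intros GDERIV_along_line assms refl | simp)+
    have "(gradf (y + t *\<^sub>R d) - gradf y) \<bullet> d \<le> norm (gradf (y + t *\<^sub>R d) - gradf y) * norm d"
      by (rule norm_cauchy_schwarz)
    also have "\<dots> \<le> (L * norm (t *\<^sub>R d)) * norm d"
      using lipschitz_onD[OF assms(1), of "y + t *\<^sub>R d" y]
      by (intro mult_right_mono) (auto simp: dist_norm)
    also have "\<dots> = L * t * (norm d)\<^sup>2"
      using t by (simp add: power2_eq_square)
    finally have "gradf (y + t *\<^sub>R d) \<bullet> d - gradf y \<bullet> d - L * t * (norm d)\<^sup>2 \<le> 0"
      by (simp add: inner_diff_left)
    with deriv show "\<exists>D. (?\<phi> has_real_derivative D) (at t) \<and> D \<le> 0"
      by blast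
  qed simp
  then show ?thesis
    by (simp add: d_def)
qed

lemma composite_eps_subgradient:
  fixes f :: "'a::real_inner \<Rightarrow> real"
  assumes "convex_on UNIV f" and "\<And>x. GDERIV f x :> gradf x"
    and "u \<in> eps_subdiff \<epsilon> g p"
  shows "u + gradf y \<in> eps_subdiff (\<epsilon> + (f p - (f y + gradf y \<bullet> (p - y)))) (composite f g) p"
  unfolding eps_subdiff_def
proof safe
  fix z
  let ?e = "\<epsilon> + (f p - (f y + gradf y \<bullet> (p - y)))"
  have "f y + gradf y \<bullet> (z - y) \<le> f z"
    by (rule convex_gradient_inequality[OF assms(1,2)])
  then have f: "f p + ((u + gradf y) \<bullet> (z - p) - ?e) \<le> f z + (u \<bullet> (z - p) - \<epsilon>)"
    by (simp add: inner_simps)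
  have "composite f g p + ereal ((u + gradf y) \<bullet> (z - p) - ?e)
      = g p + ereal (f p + ((u + gradf y) \<bullet> (z - p) - ?e))"
    by (cases "g p") (simp_all add: composite_def)
  also have "\<dots> \<le> g p + ereal (f z + (u \<bullet> (z - p) - \<epsilon>))"
    using f by (intro add_left_mono) simp
  also have "\<dots> = ereal (f z) + (g p + ereal (u \<bullet> (z - p) - \<epsilon>))"
    by (cases "g p") simp_all
  also have "\<dots> \<le> composite f g z"
    using assms(3) unfolding composite_def eps_subdiff_def by (intro add_left_mono) auto
  finally show "composite f g p + ereal ((u + gradf y) \<bullet> (z - p) - ?e) \<le> composite f g z" .
qed

section \<open>One accelerated proximal step\<close>

text \<open>Here \<open>\<phi>\<close> and \<open>\<phi>'\<close> are the values of \<open>F - F p\<close> at \<open>q\<close> and \<open>q'\<close>; the assumptions \<open>at_q\<close> and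
  \<open>at_p\<close> are the \<open>e\<close>-subgradient inequality of \<open>F\<close> at \<open>q'\<close>, tested at \<open>q\<close> and \<open>p\<close>. Adding them with
  the weights \<open>t\<close> and \<open>a\<close> leaves the term \<open>a r \<bullet> (p - x)\<close>, which the extragradient step \<open>x - a r\<close>
  cancels. What remains is a perfect square because of \<open>a\<^sup>2 = lam t'\<close>. The first inequality is
  multiplied by \<open>t\<close> so that it can also be used in the initial step, where \<open>t = 0\<close> and \<open>F q\<close> may be
  infinite.\<close>

lemma accelerated_step:
  fixes x y r p q q' :: "'a::real_inner" and t t' a lam \<phi> \<phi>' e s :: real
  assumes "0 < lam" and "0 < t'" and "0 \<le> a" and t': "t' = t + a" and a: "a\<^sup>2 = lam * t'"
    and y: "t' *\<^sub>R y = t *\<^sub>R q + a *\<^sub>R x"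
    and at_q: "t * (\<phi>' + r \<bullet> (q - q') - e) \<le> t * \<phi>"
    and at_p: "\<phi>' + r \<bullet> (p - q') - e \<le> 0"
    and err: "(norm (lam *\<^sub>R r + q' - y))\<^sup>2 + 2 * lam * e \<le> s * (norm (q' - y))\<^sup>2"
  shows "t' * \<phi>' + (norm (x - a *\<^sub>R r - p))\<^sup>2 / 2 + (1 - s) / (2 * lam) * (t' * (norm (q' - y))\<^sup>2)
      \<le> t * \<phi> + (norm (x - p))\<^sup>2 / 2"
proof -
  have at_p': "a * (\<phi>' + r \<bullet> (p - q') - e) \<le> 0"
    using at_p \<open>0 \<le> a\<close> by (simp add: mult_nonneg_nonpos)
  have "t' * (r \<bullet> y) = t * (r \<bullet> q) + a * (r \<bullet> x)"
    using arg_cong[OF y, of "\<lambda>w. r \<bullet> w"] by (simp add: inner_simps)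
  then have comb: "t' * \<phi>' + t' * (r \<bullet> (y - q')) + a * (r \<bullet> (p - x)) - t' * e \<le> t * \<phi>"
    using at_q at_p' by (simp add: t' inner_simps algebra_simps)
  have dist: "(norm (x - a *\<^sub>R r - p))\<^sup>2
      = (norm (x - p))\<^sup>2 + 2 * a * (r \<bullet> (p - x)) + lam * t' * (norm r)\<^sup>2"
    unfolding a[symmetric] power2_norm_eq_inner
    by (simp add: inner_simps inner_commute power2_eq_square algebra_simps)
  have sq: "(norm (lam *\<^sub>R r + q' - y))\<^sup>2
      = lam\<^sup>2 * (norm r)\<^sup>2 - 2 * lam * (r \<bullet> (y - q')) + (norm (q' - y))\<^sup>2"
    unfolding power2_norm_eq_inner
    by (simp add: inner_simps inner_commute power2_eq_square algebra_simps)
  have "lam * t' * (norm r)\<^sup>2 / 2 - t' * (r \<bullet> (y - q')) + t' * e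
      + (1 - s) / (2 * lam) * (t' * (norm (q' - y))\<^sup>2)
    = t' / (2 * lam) * ((norm (lam *\<^sub>R r + q' - y))\<^sup>2 + 2 * lam * e - s * (norm (q' - y))\<^sup>2)"
    unfolding sq using \<open>0 < lam\<close> by (simp add: field_simps power2_eq_square)
  also have "\<dots> \<le> 0"
    using err \<open>0 < lam\<close> \<open>0 < t'\<close> by (intro mult_nonneg_nonpos) auto
  finally have "lam * t' * (norm r)\<^sup>2 / 2 - t' * (r \<bullet> (y - q')) + t' * e
      + (1 - s) / (2 * lam) * (t' * (norm (q' - y))\<^sup>2) \<le> 0" .
  then show ?thesis
    using comb dist by linarith
qed

section \<open>Runs of IE-FISTA\<close>

locale ie_fista_run =
  fixes L \<alpha> \<sigma> :: real and f :: "'a::euclidean_space \<Rightarrow> real" and gradf :: "'a \<Rightarrow> 'a"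
    and g :: "'a \<Rightarrow> ereal" and x :: "nat \<Rightarrow> 'a" and \<tau> :: "nat \<Rightarrow> real"
    and y xt v :: "nat \<Rightarrow> 'a" and \<epsilon> :: "nat \<Rightarrow> real"
  assumes L_pos: "0 < L" and alpha_pos: "0 < \<alpha>"
    and problem: "composite_problem L f gradf g"
    and run: "ie_fista L \<alpha> \<sigma> gradf g x \<tau> y xt v \<epsilon>"
begin

definition lam :: real where "lam = \<alpha> / (1 + \<alpha> * L)"

definition s :: real where "s = (\<sigma>\<^sup>2 + \<alpha> * L) / (1 + \<alpha> * L)"

abbreviation F :: "'a \<Rightarrow> ereal" where "F \<equiv> composite f g"

abbreviation \<mu> :: "nat \<Rightarrow> real" where "\<mu> \<equiv> ie_fista_mu f gradf y xt"

abbreviation r :: "nat \<Rightarrow> 'a" where "r \<equiv> ie_fista_res L y xt v"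

lemma scale_pos: "0 < 1 + \<alpha> * L"
  using L_pos alpha_pos by (simp add: add_pos_pos)

lemma lam_pos: "0 < lam"
  using scale_pos alpha_pos by (simp add: lam_def)

lemma s_less_1:
  assumes "0 \<le> \<sigma>" and "\<sigma> < 1"
  shows "s < 1"
proof -
  have "\<sigma>\<^sup>2 < 1"
    using assms by (simp add: power_less_one_iff)
  then show ?thesis
    using scale_pos by (simp add: s_def)
qed

lemma convex_f: "convex_on UNIV f"
  and gradient: "\<And>z. GDERIV f z :> gradf z"
  and lipschitz_gradient: "L-lipschitz_on UNIV gradf"
  and finite_optimum: "\<bar>INF z. F z\<bar> \<noteq> \<infinity>"
  and minimizers_nonempty: "minimizers F \<noteq> {}"
  using problem unfolding composite_problem_def by auto

lemma tau_0: "\<tau> 0 = 0"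
  and tau_Suc: "\<And>k. \<tau> (Suc k) = \<tau> k + (lam + sqrt (lam\<^sup>2 + 4 * lam * \<tau> k)) / 2"
  and y_eq: "\<And>k. y k = (\<tau> k / \<tau> (Suc k)) *\<^sub>R xt k + ((\<tau> (Suc k) - \<tau> k) / \<tau> (Suc k)) *\<^sub>R x k"
  and eps_nonneg: "\<And>k. 0 \<le> \<epsilon> (Suc k)"
  and v_mem: "\<And>k. v (Suc k) \<in> (\<lambda>u. u + L *\<^sub>R (xt (Suc k) - y k) + gradf (y k))
                      ` eps_subdiff (\<epsilon> (Suc k)) g (xt (Suc k))"
  and v_err: "\<And>k. (norm (\<alpha> *\<^sub>R v (Suc k) + xt (Suc k) - y k))\<^sup>2 + 2 * \<alpha> * \<epsilon> (Suc k)
          \<le> \<sigma>\<^sup>2 * (norm (xt (Suc k) - y k))\<^sup>2"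
  and x_Suc: "\<And>k. x (Suc k) = x k - (\<tau> (Suc k) - \<tau> k) *\<^sub>R r (Suc k)"
  using run unfolding ie_fista_def Let_def lam_def ie_fista_res_def diff_Suc_1
  by - (elim conjE, (assumption | erule allE, elim conjE, assumption))+

lemma r_mem_eps_subdiff_g:
  "r (Suc k) \<in> (\<lambda>u. u + gradf (y k)) ` eps_subdiff (\<epsilon> (Suc k)) g (xt (Suc k))"
proof -
  obtain u where u: "u \<in> eps_subdiff (\<epsilon> (Suc k)) g (xt (Suc k))"
    and v: "v (Suc k) = u + L *\<^sub>R (xt (Suc k) - y k) + gradf (y k)"
    using v_mem[of k] by blast
  have "r (Suc k) = u + gradf (y k)"
    unfolding ie_fista_res_def v by (simp add: scaleR_diff_right)
  with u show ?thesis
    by blast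
qed

lemma eps_subdiff_g_subset:
  "(\<lambda>u. u + gradf (y k)) ` eps_subdiff (\<epsilon> (Suc k)) g (xt (Suc k))
    \<subseteq> eps_subdiff (\<epsilon> (Suc k) + \<mu> (Suc k)) F (xt (Suc k))"
  unfolding ie_fista_mu_def diff_Suc_1
  by (rule image_subsetI) (rule composite_eps_subgradient[OF convex_f gradient])

lemma r_mem_eps_subdiff_F: "r (Suc k) \<in> eps_subdiff (\<epsilon> (Suc k) + \<mu> (Suc k)) F (xt (Suc k))"
  by (rule subsetD[OF eps_subdiff_g_subset r_mem_eps_subdiff_g])

lemma mu_nonneg: "0 \<le> \<mu> (Suc k)"
  using convex_gradient_inequality[OF convex_f gradient, of "y k" "xt (Suc k)"]
  by (simp add: ie_fista_mu_def)

lemma mu_le: "\<mu> (Suc k) \<le> L / 2 * (norm (xt (Suc k) - y k))\<^sup>2"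
  using lipschitz_gradient_descent[OF lipschitz_gradient gradient, of "xt (Suc k)" "y k"]
  by (simp add: ie_fista_mu_def)

text \<open>Substituting \<open>v = r + L (xt - y)\<close> turns the criterion of the algorithm, divided by
  \<open>1 + \<alpha> L\<close>, into \<open>(1 + \<alpha> L) \<parallel>lam r + xt - y\<parallel>\<^sup>2 + 2 lam \<epsilon> \<le> \<sigma>\<^sup>2 / (1 + \<alpha> L) \<parallel>xt - y\<parallel>\<^sup>2\<close>. The term
  \<open>2 lam \<mu>\<close> costs another \<open>lam L \<parallel>xt - y\<parallel>\<^sup>2\<close>.\<close>

lemma relative_error:
  "(norm (lam *\<^sub>R r (Suc k) + xt (Suc k) - y k))\<^sup>2 + 2 * lam * (\<epsilon> (Suc k) + \<mu> (Suc k))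
    \<le> s * (norm (xt (Suc k) - y k))\<^sup>2"
proof -
  let ?b = "1 + \<alpha> * L" and ?D = "(norm (xt (Suc k) - y k))\<^sup>2"
  let ?N = "(norm (lam *\<^sub>R r (Suc k) + xt (Suc k) - y k))\<^sup>2"
  have b: "?b * lam = \<alpha>"
    using scale_pos by (simp add: lam_def)
  have bs: "?b * s = \<sigma>\<^sup>2 + \<alpha> * L"
    using scale_pos by (simp add: s_def)
  have v: "v (Suc k) = r (Suc k) + L *\<^sub>R (xt (Suc k) - y k)"
    by (simp add: ie_fista_res_def algebra_simps)
  have "\<alpha> *\<^sub>R v (Suc k) + xt (Suc k) - y k = ?b *\<^sub>R (lam *\<^sub>R r (Suc k) + xt (Suc k) - y k)"
    unfolding v scaleR_add_right scaleR_diff_right scaleR_scaleR b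
    by (simp add: algebra_simps)
  then have "?b\<^sup>2 * ?N + 2 * \<alpha> * \<epsilon> (Suc k) \<le> \<sigma>\<^sup>2 * ?D"
    using v_err[of k] by (simp add: power_mult_distrib)
  moreover have "?b * ?N \<le> ?b\<^sup>2 * ?N"
    using L_pos alpha_pos by (intro mult_right_mono self_le_power) auto
  moreover have "2 * \<alpha> * \<mu> (Suc k) \<le> 2 * \<alpha> * (L / 2 * ?D)"
    using mu_le alpha_pos by (intro mult_left_mono) auto
  ultimately have "?b * ?N + 2 * (?b * lam) * (\<epsilon> (Suc k) + \<mu> (Suc k)) \<le> (\<sigma>\<^sup>2 + \<alpha> * L) * ?D"
    unfolding b by (simp add: algebra_simps)
  then have "?b * (?N + 2 * lam * (\<epsilon> (Suc k) + \<mu> (Suc k))) \<le> ?b * (s * ?D)"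
    unfolding bs[symmetric] by (simp add: algebra_simps)
  then show ?thesis
    using scale_pos by (simp only: mult_le_cancel_left_pos)
qed

section \<open>Growth of the step parameters\<close>

text \<open>The lower bound \<open>lam k\<^sup>2 / 4\<close> reproduces itself: it makes the square root at least \<open>lam k\<close>.\<close>

lemma tau_ge: "lam * (real k)\<^sup>2 / 4 \<le> \<tau> k"
proof (induction k)
  case 0
  then show ?case by (simp add: tau_0)
next
  case (Suc k)
  have "4 * lam * (lam * (real k)\<^sup>2 / 4) \<le> 4 * lam * \<tau> k"
    using Suc lam_pos by (intro mult_left_mono) auto
  then have "(lam * real k)\<^sup>2 \<le> 4 * lam * \<tau> k"
    by (simp add: power2_eq_square algebra_simps)
  then have "(lam * real k)\<^sup>2 \<le> lam\<^sup>2 + 4 * lam * \<tau> k"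
    by (rule order_trans) simp
  then have "lam * real k \<le> sqrt (lam\<^sup>2 + 4 * lam * \<tau> k)"
    by (rule real_le_rsqrt)
  then have "lam * (real k)\<^sup>2 / 4 + (lam + lam * real k) / 2 \<le> \<tau> (Suc k)"
    using Suc by (simp add: tau_Suc add_mono)
  moreover have "lam * (real (Suc k))\<^sup>2 / 4 \<le> lam * (real k)\<^sup>2 / 4 + (lam + lam * real k) / 2"
    using lam_pos by (simp add: power2_eq_square algebra_simps)
  ultimately show ?case by linarith
qed

lemma tau_nonneg: "0 \<le> \<tau> k"
  using tau_ge[of k] lam_pos by (meson divide_nonneg_pos less_eq_real_def mult_nonneg_nonneg
    order_trans zero_le_power2 zero_less_numeral)

lemma tau_Suc_pos: "0 < \<tau> (Suc k)"
  using tau_ge[of "Suc k"] lam_pos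
  by (smt (verit) divide_pos_pos mult_pos_pos of_nat_0_less_iff zero_less_Suc zero_less_power)

lemma tau_diff_nonneg: "0 \<le> \<tau> (Suc k) - \<tau> k"
  using tau_nonneg[of k] lam_pos by (simp add: tau_Suc)

text \<open>The increment is the positive root of \<open>a\<^sup>2 = lam (\<tau> k + a)\<close>.\<close>

lemma tau_diff_square: "(\<tau> (Suc k) - \<tau> k)\<^sup>2 = lam * \<tau> (Suc k)"
proof -
  define w where "w = sqrt (lam\<^sup>2 + 4 * lam * \<tau> k)"
  have "w\<^sup>2 = lam\<^sup>2 + 4 * lam * \<tau> k"
    unfolding w_def using tau_nonneg[of k] lam_pos
    by (intro real_sqrt_pow2 add_nonneg_nonneg mult_nonneg_nonneg) auto
  moreover have tau: "\<tau> (Suc k) = \<tau> k + (lam + w) / 2"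
    by (simp only: tau_Suc w_def)
  ultimately show ?thesis
    unfolding tau by (simp add: power2_eq_square field_simps)
qed

lemma tau_y: "\<tau> (Suc k) *\<^sub>R y k = \<tau> k *\<^sub>R xt k + (\<tau> (Suc k) - \<tau> k) *\<^sub>R x k"
  unfolding y_eq[of k] using tau_Suc_pos[of k] by (simp add: scaleR_add_right)

lemma sum_tau_ge: "lam * real n ^ 3 / 12 \<le> (\<Sum>k<n. \<tau> (Suc k))"
proof (induction n)
  case (Suc n)
  have "lam * real (Suc n) ^ 3 / 12 \<le> lam * real n ^ 3 / 12 + lam * (real (Suc n))\<^sup>2 / 4"
    using lam_pos by (simp add: power2_eq_square power3_eq_cube algebra_simps)
  then show ?case
    using Suc tau_ge[of "Suc n"] by simp
qed simp

section \<open>Energy decay\<close>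

lemma F_minimizer_finite:
  assumes "p \<in> minimizers F"
  shows "\<bar>F p\<bar> \<noteq> \<infinity>"
proof -
  have "(INF z. F z) = F p"
    using assms unfolding minimizers_def by (intro INF_eqI) auto
  then show ?thesis
    using finite_optimum by simp
qed

text \<open>An \<open>\<epsilon>\<close>-subgradient at a point of infinite value would force \<open>F\<close> to be infinite everywhere.
  The starting point is exempt: \<open>F (xt 0)\<close> can be \<open>\<infinity>\<close>.\<close>

lemma F_iterate_finite: "\<bar>F (xt (Suc k))\<bar> \<noteq> \<infinity>"
proof -
  obtain p where p: "p \<in> minimizers F"
    using minimizers_nonempty by blast
  have "F (xt (Suc k)) + ereal (r (Suc k) \<bullet> (p - xt (Suc k)) - (\<epsilon> (Suc k) + \<mu> (Suc k))) \<le> F p"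
    using r_mem_eps_subdiff_F[of k] unfolding eps_subdiff_def by auto
  moreover have "F p \<le> F (xt (Suc k))"
    using p unfolding minimizers_def by auto
  ultimately show ?thesis
    using F_minimizer_finite[OF p] by (cases "F p"; cases "F (xt (Suc k))") auto
qed

lemma real_eps_subgradient:
  assumes "\<bar>F z\<bar> \<noteq> \<infinity>"
  shows "real_of_ereal (F (xt (Suc k)))
      + (r (Suc k) \<bullet> (z - xt (Suc k)) - (\<epsilon> (Suc k) + \<mu> (Suc k))) \<le> real_of_ereal (F z)"
proof -
  have "F (xt (Suc k)) + ereal (r (Suc k) \<bullet> (z - xt (Suc k)) - (\<epsilon> (Suc k) + \<mu> (Suc k))) \<le> F z"
    using r_mem_eps_subdiff_F[of k] unfolding eps_subdiff_def by auto
  then show ?thesis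
    using assms F_iterate_finite[of k] by (cases "F z"; cases "F (xt (Suc k))") auto
qed

text \<open>The telescoped steps. If \<open>F (xt 0) = \<infinity>\<close>, then \<open>real_of_ereal\<close> gives \<open>\<phi> 0\<close> a meaningless value,
  but its weight is \<open>\<tau> 0 = 0\<close>.\<close>

lemma energy_decay:
  assumes p: "p \<in> minimizers F"
  defines "\<phi> \<equiv> \<lambda>k. real_of_ereal (F (xt k)) - real_of_ereal (F p)"
  shows "\<tau> n * \<phi> n + (norm (x n - p))\<^sup>2 / 2
        + (1 - s) / (2 * lam) * (\<Sum>k<n. \<tau> (Suc k) * (norm (xt (Suc k) - y k))\<^sup>2)
      \<le> (norm (x 0 - p))\<^sup>2 / 2"
proof (induction n)
  case 0
  then show ?case by (simp add: tau_0)
next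
  case (Suc n)
  let ?e = "\<epsilon> (Suc n) + \<mu> (Suc n)" and ?D = "(norm (xt (Suc n) - y n))\<^sup>2"
  have at_p: "\<phi> (Suc n) + r (Suc n) \<bullet> (p - xt (Suc n)) - ?e \<le> 0"
    using real_eps_subgradient[OF F_minimizer_finite[OF p], of n] by (simp add: \<phi>_def)
  have at_q: "\<tau> n * (\<phi> (Suc n) + r (Suc n) \<bullet> (xt n - xt (Suc n)) - ?e) \<le> \<tau> n * \<phi> n"
  proof (cases n)
    case 0
    then show ?thesis by (simp add: tau_0)
  next
    case (Suc m)
    then have "\<phi> (Suc n) + r (Suc n) \<bullet> (xt n - xt (Suc n)) - ?e \<le> \<phi> n"
      using real_eps_subgradient[OF F_iterate_finite[of m], of n] by (simp add: \<phi>_def)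
    then show ?thesis
      using tau_nonneg by (intro mult_left_mono)
  qed
  have "\<tau> (Suc n) * \<phi> (Suc n) + (norm (x (Suc n) - p))\<^sup>2 / 2
        + (1 - s) / (2 * lam) * (\<tau> (Suc n) * ?D)
      \<le> \<tau> n * \<phi> n + (norm (x n - p))\<^sup>2 / 2"
    unfolding x_Suc
    by (rule accelerated_step[OF lam_pos tau_Suc_pos tau_diff_nonneg _ tau_diff_square tau_y
          at_q at_p relative_error]) simp
  then show ?case
    using Suc unfolding sum.lessThan_Suc distrib_left by linarith
qed

text \<open>The energy at step \<open>n\<close> is nonnegative, so its decay bounds the sum by the squared distance to
  every minimizer. Passing to the infimum of these distances gives \<open>infdist\<close>.\<close>

lemma weighted_displacements_le:
  assumes "s < 1"
  shows "(\<Sum>k<n. \<tau> (Suc k) * (norm (xt (Suc k) - y k))\<^sup>2)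
      \<le> lam / (1 - s) * (infdist (x 0) (minimizers F))\<^sup>2"
proof -
  let ?S = "\<Sum>k<n. \<tau> (Suc k) * (norm (xt (Suc k) - y k))\<^sup>2"
  have c: "0 < (1 - s) / lam"
    using assms lam_pos by simp
  have "sqrt ((1 - s) / lam * ?S) \<le> infdist (x 0) (minimizers F)"
    unfolding infdist_notempty[OF minimizers_nonempty]
  proof (rule cINF_greatest[OF minimizers_nonempty])
    fix p
    assume p: "p \<in> minimizers F"
    have "0 \<le> \<tau> n * (real_of_ereal (F (xt n)) - real_of_ereal (F p))"
    proof (cases n)
      case 0
      then show ?thesis by (simp add: tau_0)
    next
      case (Suc m)
      have "F p \<le> F (xt n)"
        using p unfolding minimizers_def by auto
      then have "real_of_ereal (F p) \<le> real_of_ereal (F (xt n))"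
        using F_minimizer_finite[OF p] F_iterate_finite[of m] Suc
        by (cases "F p"; cases "F (xt n)") auto
      then show ?thesis
        using tau_nonneg by simp
    qed
    then have "(1 - s) / (2 * lam) * ?S \<le> (norm (x 0 - p))\<^sup>2 / 2"
      using energy_decay[OF p, of n] zero_le_power2[of "norm (x n - p)"] by linarith
    then have "(1 - s) / lam * ?S \<le> (dist (x 0) p)\<^sup>2"
      by (simp add: dist_norm)
    then show "sqrt ((1 - s) / lam * ?S) \<le> dist (x 0) p"
      by (intro real_le_lsqrt) auto
  qed
  then have "(1 - s) / lam * ?S \<le> (infdist (x 0) (minimizers F))\<^sup>2"
    by (rule sqrt_le_D)
  then show ?thesis
    using c assms lam_pos by (simp add: field_simps)
qed

section \<open>Rate of the residues\<close>

text \<open>Otherwise all displacements up to \<open>n\<close> would exceed \<open>m\<close>, and since the weights \<open>\<tau>\<close> sum to at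
  least \<open>lam n\<^sup>3 / 12\<close>, the weighted sum would exceed its bound.\<close>

lemma small_displacement:
  assumes "s < 1" and "0 < n"
  shows "\<exists>k<n. (norm (xt (Suc k) - y k))\<^sup>2 * real n ^ 3
      \<le> 12 / (1 - s) * (infdist (x 0) (minimizers F))\<^sup>2"
proof (rule ccontr)
  let ?d = "infdist (x 0) (minimizers F)"
  define m where "m = 12 / (1 - s) * ?d\<^sup>2 / real n ^ 3"
  assume "\<not> ?thesis"
  then have "12 / (1 - s) * ?d\<^sup>2 < (norm (xt (Suc k) - y k))\<^sup>2 * real n ^ 3" if "k < n" for k
    using that by (meson not_le)
  then have m: "m < (norm (xt (Suc k) - y k))\<^sup>2" if "k < n" for k
    unfolding m_def using that \<open>0 < n\<close> by (subst pos_divide_less_eq) simp_all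
  have m_nonneg: "0 \<le> m"
    using assms by (simp add: m_def)
  have "lam / (1 - s) * ?d\<^sup>2 = lam * real n ^ 3 / 12 * m"
    using assms by (simp add: m_def)
  also have "\<dots> \<le> (\<Sum>k<n. \<tau> (Suc k)) * m"
    using sum_tau_ge m_nonneg by (intro mult_right_mono)
  also have "\<dots> = (\<Sum>k<n. \<tau> (Suc k) * m)"
    by (rule sum_distrib_right)
  also have "\<dots> < (\<Sum>k<n. \<tau> (Suc k) * (norm (xt (Suc k) - y k))\<^sup>2)"
    using m tau_Suc_pos \<open>0 < n\<close> by (intro sum_strict_mono mult_strict_left_mono) auto
  finally show False
    using weighted_displacements_le[OF \<open>s < 1\<close>, of n] by simp
qed

text \<open>For \<open>s < 1\<close> the relative error criterion says that \<open>lam r\<close> differs from \<open>y - xt\<close> by at most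
  \<open>\<parallel>xt - y\<parallel>\<close>; the constants are rounded up by replacing \<open>s\<close> by \<open>1\<close>.\<close>

lemma residue_le_displacement:
  assumes "s < 1"
  shows "norm (r (Suc k)) \<le> 2 / lam * norm (xt (Suc k) - y k)"
    and "\<epsilon> (Suc k) + \<mu> (Suc k) \<le> (norm (xt (Suc k) - y k))\<^sup>2 / (2 * lam)"
proof -
  let ?N = "norm (xt (Suc k) - y k)"
  have err: "(norm (lam *\<^sub>R r (Suc k) + xt (Suc k) - y k))\<^sup>2 + 2 * lam * (\<epsilon> (Suc k) + \<mu> (Suc k)) \<le> ?N\<^sup>2"
    using relative_error[of k] mult_right_mono[of s 1 "?N\<^sup>2"] assms by simp
  have "0 \<le> 2 * lam * (\<epsilon> (Suc k) + \<mu> (Suc k))"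
    using lam_pos eps_nonneg mu_nonneg by simp
  then have "(norm (lam *\<^sub>R r (Suc k) + xt (Suc k) - y k))\<^sup>2 \<le> ?N\<^sup>2"
    using err by linarith
  then have "norm (lam *\<^sub>R r (Suc k) + xt (Suc k) - y k) \<le> ?N"
    by (rule power2_le_imp_le) simp
  moreover have "norm (lam *\<^sub>R r (Suc k))
      \<le> norm (lam *\<^sub>R r (Suc k) + xt (Suc k) - y k) + norm (xt (Suc k) - y k)"
    using norm_triangle_ineq4[of "lam *\<^sub>R r (Suc k) + xt (Suc k) - y k" "xt (Suc k) - y k"]
    by simp
  ultimately have "lam * norm (r (Suc k)) \<le> 2 * ?N"
    using lam_pos by simp
  then show "norm (r (Suc k)) \<le> 2 / lam * ?N"
    using lam_pos by (simp add: field_simps)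
  have "2 * lam * (\<epsilon> (Suc k) + \<mu> (Suc k)) \<le> ?N\<^sup>2"
    using err zero_le_power2[of "norm (lam *\<^sub>R r (Suc k) + xt (Suc k) - y k)"] by linarith
  then show "\<epsilon> (Suc k) + \<mu> (Suc k) \<le> ?N\<^sup>2 / (2 * lam)"
    using lam_pos by (simp add: field_simps)
qed

text \<open>With \<open>K = 12 / (1 - s)\<close>, the constant of \<open>small_displacement\<close>, the bounds on \<open>C\<close> say
  \<open>32 K / lam\<^sup>2 \<le> C\<^sup>3\<close> and \<open>4 K / lam \<le> C\<^sup>3\<close>. The first one makes \<open>\<parallel>r l\<parallel>\<close> and the second one
  \<open>\<epsilon> l + \<mu> l\<close> at most \<open>\<rho>\<close>. For the number \<open>n\<close> of iterations
  the integer part of \<open>max 1 (C q)\<close> with \<open>q = (d0 / \<rho>) powr (2 / 3)\<close> is used; it is at least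
  \<open>C q / 2\<close>, whence \<open>C\<^sup>3 (d0 / \<rho>)\<^sup>2 \<le> 8 n\<^sup>3\<close>.\<close>

lemma iteration_complexity:
  fixes \<rho> C :: real
  assumes "s < 1" and "0 < \<rho>" and "\<rho> < 1" and "0 < C"
    and C1: "384 / ((1 - s) * lam\<^sup>2) \<le> C ^ 3" and C2: "48 / ((1 - s) * lam) \<le> C ^ 3"
  shows "\<exists>l\<ge>1. real l \<le> max 1 (C * (infdist (x 0) (minimizers F) / \<rho>) powr (2 / 3)) \<and>
      approx_solution F \<rho> (xt l) (r l) (\<epsilon> l + \<mu> l)"
proof -
  define d where "d = infdist (x 0) (minimizers F)"
  define q where "q = (d / \<rho>) powr (2 / 3)"
  define n where "n = nat \<lfloor>max 1 (C * q)\<rfloor>"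
  have d_nonneg: "0 \<le> d"
    by (simp add: d_def infdist_nonneg)
  have n_le: "real n \<le> max 1 (C * q)" and n_pos: "1 \<le> n"
    unfolding n_def by linarith+
  have Cq: "C * q \<le> 2 * real n"
  proof -
    have "max 1 (C * q) < real n + 1"
      unfolding n_def by linarith
    then show ?thesis
      using n_pos by linarith
  qed
  have "q ^ 3 = (d / \<rho>)\<^sup>2"
  proof (cases "d = 0")
    case False
    then have pos: "0 < d / \<rho>"
      using d_nonneg \<open>0 < \<rho>\<close> by simp
    then have "0 < q"
      unfolding q_def by (simp only: powr_gt_zero)
    then have "q ^ 3 = q powr real 3"
      by (rule powr_realpow[symmetric])
    also have "\<dots> = (d / \<rho>) powr real 2"
      unfolding q_def powr_powr by simp
    also have "\<dots> = (d / \<rho>)\<^sup>2"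
      using pos by (rule powr_realpow)
    finally show ?thesis .
  qed (simp add: q_def)
  moreover have "(C * q) ^ 3 \<le> (2 * real n) ^ 3"
    using Cq \<open>0 < C\<close> by (intro power_mono) (auto simp: q_def)
  ultimately have "C ^ 3 * (d / \<rho>)\<^sup>2 \<le> 8 * real n ^ 3"
    by (simp add: power_mult_distrib)
  then have n_large: "C ^ 3 * d\<^sup>2 \<le> 8 * real n ^ 3 * \<rho>\<^sup>2"
    using \<open>0 < \<rho>\<close> by (simp add: power_divide divide_le_eq)
  obtain k where k: "k < n" and D: "(norm (xt (Suc k) - y k))\<^sup>2 * real n ^ 3 \<le> 12 / (1 - s) * d\<^sup>2"
    using small_displacement[OF \<open>s < 1\<close>, of n] n_pos unfolding d_def by auto
  define N where "N = norm (xt (Suc k) - y k)"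
  have C3: "0 < C ^ 3"
    using \<open>0 < C\<close> by simp
  have "real n ^ 3 * (C ^ 3 * N\<^sup>2) \<le> C ^ 3 * (12 / (1 - s) * d\<^sup>2)"
    using mult_left_mono[OF D, of "C ^ 3"] C3 by (simp add: N_def mult_ac)
  also have "\<dots> = 12 / (1 - s) * (C ^ 3 * d\<^sup>2)"
    by simp
  also have "\<dots> \<le> 12 / (1 - s) * (8 * real n ^ 3 * \<rho>\<^sup>2)"
    using n_large \<open>s < 1\<close> by (intro mult_left_mono) auto
  also have "\<dots> = real n ^ 3 * (96 / (1 - s) * \<rho>\<^sup>2)"
    by simp
  finally have N: "C ^ 3 * N\<^sup>2 \<le> 96 / (1 - s) * \<rho>\<^sup>2"
    using n_pos by (subst (asm) mult_le_cancel_left_pos) auto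
  have "C ^ 3 * (2 / lam * N)\<^sup>2 = 4 / lam\<^sup>2 * (C ^ 3 * N\<^sup>2)"
    by (simp add: power_mult_distrib power_divide)
  also have "\<dots> \<le> 4 / lam\<^sup>2 * (96 / (1 - s) * \<rho>\<^sup>2)"
    using N by (intro mult_left_mono) auto
  also have "\<dots> = 384 / ((1 - s) * lam\<^sup>2) * \<rho>\<^sup>2"
    using lam_pos \<open>s < 1\<close> by (simp add: field_simps)
  also have "\<dots> \<le> C ^ 3 * \<rho>\<^sup>2"
    using C1 by (intro mult_right_mono) auto
  finally have "(2 / lam * N)\<^sup>2 \<le> \<rho>\<^sup>2"
    using C3 by (simp only: mult_le_cancel_left_pos)
  then have "2 / lam * N \<le> \<rho>"
    by (rule power2_le_imp_le) (use \<open>0 < \<rho>\<close> in simp)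
  then have r_le: "norm (r (Suc k)) \<le> \<rho>"
    using residue_le_displacement(1)[OF \<open>s < 1\<close>, of k] unfolding N_def by linarith
  have "C ^ 3 * (N\<^sup>2 / (2 * lam)) = 1 / (2 * lam) * (C ^ 3 * N\<^sup>2)"
    by simp
  also have "\<dots> \<le> 1 / (2 * lam) * (96 / (1 - s) * \<rho>\<^sup>2)"
    using N lam_pos by (intro mult_left_mono) auto
  also have "\<dots> = 48 / ((1 - s) * lam) * \<rho>\<^sup>2"
    using lam_pos \<open>s < 1\<close> by (simp add: field_simps)
  also have "\<dots> \<le> C ^ 3 * \<rho>\<^sup>2"
    using C2 by (intro mult_right_mono) auto
  also have "\<dots> \<le> C ^ 3 * \<rho>"
    using C3 \<open>0 < \<rho>\<close> \<open>\<rho> < 1\<close> by (intro mult_left_mono) (auto simp: power2_eq_square mult_le_cancel_left1)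
  finally have "N\<^sup>2 / (2 * lam) \<le> \<rho>"
    using C3 by (simp only: mult_le_cancel_left_pos)
  then have e_le: "\<epsilon> (Suc k) + \<mu> (Suc k) \<le> \<rho>"
    using residue_le_displacement(2)[OF \<open>s < 1\<close>, of k] unfolding N_def by linarith
  have "approx_solution F \<rho> (xt (Suc k)) (r (Suc k)) (\<epsilon> (Suc k) + \<mu> (Suc k))"
    unfolding approx_solution_def
    using r_le e_le r_mem_eps_subdiff_F eps_nonneg mu_nonneg by (simp add: add_nonneg_nonneg)
  moreover have "real (Suc k) \<le> max 1 (C * q)"
    using k n_le by linarith
  ultimately show ?thesis
    unfolding q_def d_def by (intro exI[of _ "Suc k"]) auto
qed

end

theorem theorem5p5:
  fixes L \<alpha> \<sigma> :: real
  assumes "L > 0" and "\<alpha> > 1 / L" and "0 \<le> \<sigma>" and "\<sigma> \<le> 1"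
  shows "(\<forall>(f :: 'a::euclidean_space \<Rightarrow> real) gradf g x \<tau> y xt v \<epsilon>.
            composite_problem L f gradf g \<longrightarrow>
            ie_fista L \<alpha> \<sigma> gradf g x \<tau> y xt v \<epsilon> \<longrightarrow>
            (\<forall>k\<ge>1.
               ie_fista_res L y xt v k
                 \<in> (\<lambda>u. u + gradf (y (k - 1))) ` eps_subdiff (\<epsilon> k) g (xt k) \<and>
               (\<lambda>u. u + gradf (y (k - 1))) ` eps_subdiff (\<epsilon> k) g (xt k)
                 \<subseteq> eps_subdiff (\<epsilon> k + ie_fista_mu f gradf y xt k) (composite f g) (xt k)))
       \<and> (\<sigma> < 1 \<longrightarrow>
            (\<exists>C>0. \<forall>(f :: 'a \<Rightarrow> real) gradf g x \<tau> y xt v \<epsilon> \<rho>.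
               composite_problem L f gradf g \<longrightarrow>
               ie_fista L \<alpha> \<sigma> gradf g x \<tau> y xt v \<epsilon> \<longrightarrow>
               0 < \<rho> \<longrightarrow> \<rho> < 1 \<longrightarrow>
               (\<exists>l\<ge>1.
                  real l \<le> max 1 (C * (infdist (x 0) (minimizers (composite f g)) / \<rho>) powr (2 / 3)) \<and>
                  approx_solution (composite f g) \<rho> (xt l)
                    (ie_fista_res L y xt v l) (\<epsilon> l + ie_fista_mu f gradf y xt l))))"
proof (intro conjI allI impI)
  have "0 < 1 / L"
    using assms(1) by simp
  then have alpha: "0 < \<alpha>"
    using assms(2) by linarith
  {
    fix f :: "'a \<Rightarrow> real" and gradf g x \<tau> y xt v \<epsilon> and k :: nat
    assume "composite_problem L f gradf g" and "ie_fista L \<alpha> \<sigma> gradf g x \<tau> y xt v \<epsilon>" and k: "1 \<le> k"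
    then interpret ie_fista_run L \<alpha> \<sigma> f gradf g x \<tau> y xt v \<epsilon>
      using assms(1) alpha by unfold_locales
    obtain m where "k = Suc m"
      using k by (cases k) auto
    then show "ie_fista_res L y xt v k
          \<in> (\<lambda>u. u + gradf (y (k - 1))) ` eps_subdiff (\<epsilon> k) g (xt k)"
      and "(\<lambda>u. u + gradf (y (k - 1))) ` eps_subdiff (\<epsilon> k) g (xt k)
          \<subseteq> eps_subdiff (\<epsilon> k + ie_fista_mu f gradf y xt k) (composite f g) (xt k)"
      using r_mem_eps_subdiff_g[of m] eps_subdiff_g_subset[of m] by simp_all
  }
  assume sigma: "\<sigma> < 1"
  define lam where "lam = \<alpha> / (1 + \<alpha> * L)"
  define s where "s = (\<sigma>\<^sup>2 + \<alpha> * L) / (1 + \<alpha> * L)"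
  define A where "A = 384 / ((1 - s) * lam\<^sup>2)"
  define B where "B = 48 / ((1 - s) * lam)"
  define C where "C = 1 + \<bar>A\<bar> + \<bar>B\<bar>"
  have "1 \<le> C"
    by (simp add: C_def)
  then have "C \<le> C ^ 3"
    using power_increasing[of 1 3 C] by simp
  \<comment> \<open>The summand \<open>1\<close> lets the bounds on \<open>C ^ 3\<close> be read off from \<open>C\<close> itself.\<close>
  then have AC: "A \<le> C ^ 3" and BC: "B \<le> C ^ 3"
    unfolding C_def by linarith+
  show "\<exists>C>0. \<forall>(f :: 'a \<Rightarrow> real) gradf g x \<tau> y xt v \<epsilon> \<rho>.
               composite_problem L f gradf g \<longrightarrow>
               ie_fista L \<alpha> \<sigma> gradf g x \<tau> y xt v \<epsilon> \<longrightarrow>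
               0 < \<rho> \<longrightarrow> \<rho> < 1 \<longrightarrow>
               (\<exists>l\<ge>1.
                  real l \<le> max 1 (C * (infdist (x 0) (minimizers (composite f g)) / \<rho>) powr (2 / 3)) \<and>
                  approx_solution (composite f g) \<rho> (xt l)
                    (ie_fista_res L y xt v l) (\<epsilon> l + ie_fista_mu f gradf y xt l))"
  proof (intro exI[of _ C] conjI allI impI)
    show "0 < C"
      using \<open>1 \<le> C\<close> by simp
    fix f :: "'a \<Rightarrow> real" and gradf g x \<tau> y xt v \<epsilon> and \<rho> :: real
    assume "composite_problem L f gradf g" and "ie_fista L \<alpha> \<sigma> gradf g x \<tau> y xt v \<epsilon>"
      and rho: "0 < \<rho>" "\<rho> < 1"
    then interpret run: ie_fista_run L \<alpha> \<sigma> f gradf g x \<tau> y xt v \<epsilon>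
      using assms(1) alpha by unfold_locales
    show "\<exists>l\<ge>1.
        real l \<le> max 1 (C * (infdist (x 0) (minimizers (composite f g)) / \<rho>) powr (2 / 3)) \<and>
        approx_solution (composite f g) \<rho> (xt l)
          (ie_fista_res L y xt v l) (\<epsilon> l + ie_fista_mu f gradf y xt l)"
      using run.iteration_complexity[OF run.s_less_1[OF assms(3) sigma] rho \<open>0 < C\<close>] AC BC
      unfolding A_def B_def s_def lam_def run.s_def run.lam_def by blast
  qed
qed

end
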